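(* There is no symmetric association scheme $\mathcal{A} = (X, \{R_0, \dots, R_5\})$ with $R_0 = \mathrm{Id}_X$ whose intersection numbers, written as matrices $(p^h_{ij})_{i,j=0}^5$ for $h = 0,\dots,5$ (rows indexed by $i$, columns by $j$), are: $(p^0_{ij}) = \mathrm{diag}(1, 6, 18, 2, 6, 12)$; $(p^1_{ij})$ has rows $(0,1,0,0,0,0)$, $(1,0,3,0,2,0)$, $(0,3,9,0,0,6)$, $(0,0,0,0,0,2)$, $(0,2,0,0,0,4)$, $(0,0,6,2,4,0)$; $(p^2_{ij})$ has rows $(0,0,1,0,0,0)$, $(0,1,3,0,0,2)$, $(1,3,0,2,6,6)$, $(0,0,2,0,0,0)$, $(0,0,6,0,0,0)$, $(0,2,6,0,0,4)$; $(p^3_{ij})$ has rows $(0,0,0,1,0,0)$, $(0,0,0,0,0,6)$, $(0,0,18,0,0,0)$, $(1,0,0,1,0,0)$, $(0,0,0,0,6,0)$, $(0,6,0,0,0,6)$; $(p^4_{ij})$ has rows $(0,0,0,0,1,0)$, $(0,2,0,0,0,4)$, $(0,0,18,0,0,0)$, $(0,0,0,0,2,0)$, $(1,0,0,2,3,0)$, $(0,4,0,0,0,8)$; $(p^5_{ij})$ has rows $(0,0,0,0,0,1)$, $(0,0,3,1,2,0)$, $(0,3,9,0,0,6)$, $(0,1,0,0,0,1)$, $(0,2,0,0,0,4)$, $(1,0,6,1,4,0)$.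
   Context: A symmetric association scheme is a pair $(X, \{R_i \mid i \in \mathcal{I}\})$ where $X$ is a finite set and the $R_i$ are nonempty symmetric binary relations on $X$ partitioning $X^2$, with $R_0$ the identity relation, such that for all $h,i,j$ there is a number $p^h_{ij}$ (intersection number) with the property that for every $(x,y) \in R_h$ there are exactly $p^h_{ij}$ vertices $z$ with $(x,z) \in R_i$ and $(z,y) \in R_j$. (Such a scheme would have $45$ vertices.) *)

theory Defs
  imports "HOL-Library.Disjoint_Sets"
begin

text \<open>
  Relations are indexed by a type with a distinguished element \<open>0\<close>, the index of the identity
  relation. \<open>R\<close> is a total function; only its values on the index set \<open>I\<close> matter.
\<close>

text \<open>For \<open>R h \<noteq> {}\<close> there is at most one such \<open>n\<close>, namely $p^h_{ij}$.\<close>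

definition is_intersection_number ::
    "'a set \<Rightarrow> ('i \<Rightarrow> 'a rel) \<Rightarrow> 'i \<Rightarrow> 'i \<Rightarrow> 'i \<Rightarrow> nat \<Rightarrow> bool" where
  "is_intersection_number X R h i j n \<longleftrightarrow>
     (\<forall>(x, y) \<in> R h. card {z \<in> X. (x, z) \<in> R i \<and> (z, y) \<in> R j} = n)"

definition symmetric_association_scheme ::
    "'a set \<Rightarrow> 'i::zero set \<Rightarrow> ('i \<Rightarrow> 'a rel) \<Rightarrow> bool" where
  "symmetric_association_scheme X I R \<longleftrightarrow>
     finite X \<and>
     (\<forall>i\<in>I. R i \<noteq> {}) \<and>
     (\<forall>i\<in>I. sym (R i)) \<and>
     disjoint_family_on R I \<and>
     (\<Union>i\<in>I. R i) = X \<times> X \<and>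
     0 \<in> I \<and>
     R 0 = Id_on X \<and>
     (\<forall>h\<in>I. \<forall>i\<in>I. \<forall>j\<in>I. \<exists>n. is_intersection_number X R h i j n)"

text \<open>\<open>scheme_array ! h ! i ! j\<close> is the prescribed value of $p^h_{ij}$.\<close>

definition scheme_array :: "nat list list list" where
  "scheme_array =
    [[[1, 0, 0, 0, 0, 0],
      [0, 6, 0, 0, 0, 0],
      [0, 0, 18, 0, 0, 0],
      [0, 0, 0, 2, 0, 0],
      [0, 0, 0, 0, 6, 0],
      [0, 0, 0, 0, 0, 12]],

     [[0, 1, 0, 0, 0, 0],
      [1, 0, 3, 0, 2, 0],
      [0, 3, 9, 0, 0, 6],
      [0, 0, 0, 0, 0, 2],
      [0, 2, 0, 0, 0, 4],
      [0, 0, 6, 2, 4, 0]],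

     [[0, 0, 1, 0, 0, 0],
      [0, 1, 3, 0, 0, 2],
      [1, 3, 0, 2, 6, 6],
      [0, 0, 2, 0, 0, 0],
      [0, 0, 6, 0, 0, 0],
      [0, 2, 6, 0, 0, 4]],

     [[0, 0, 0, 1, 0, 0],
      [0, 0, 0, 0, 0, 6],
      [0, 0, 18, 0, 0, 0],
      [1, 0, 0, 1, 0, 0],
      [0, 0, 0, 0, 6, 0],
      [0, 6, 0, 0, 0, 6]],

     [[0, 0, 0, 0, 1, 0],
      [0, 2, 0, 0, 0, 4],
      [0, 0, 18, 0, 0, 0],
      [0, 0, 0, 0, 2, 0],
      [1, 0, 0, 2, 3, 0],
      [0, 4, 0, 0, 0, 8]],

     [[0, 0, 0, 0, 0, 1],
      [0, 0, 3, 1, 2, 0],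
      [0, 3, 9, 0, 0, 6],
      [0, 1, 0, 0, 0, 1],
      [0, 2, 0, 0, 0, 4],
      [1, 0, 6, 1, 4, 0]]]"

end

theory Submission
  imports Defs
begin

text \<open>
  Fix a vertex \<open>y\<close> and an \<open>R\<^sub>1\<close>-neighbour \<open>x\<close> of \<open>y\<close>. The six \<open>R\<^sub>1\<close>-neighbours of \<open>y\<close> split into the
  set \<open>N\<close> of those that are equal or \<open>R\<^sub>4\<close>-related to \<open>x\<close> and the set \<open>M\<close> of those that are
  \<open>R\<^sub>2\<close>-related to \<open>x\<close>, three in each, and every element of \<open>N\<close> is \<open>R\<^sub>2\<close>-related to every element
  of \<open>M\<close>. As $p^2_{11} = 1$, no vertex besides \<open>y\<close> is \<open>R\<^sub>1\<close>-adjacent to both an element of \<open>N\<close> and an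
  element of \<open>M\<close>. Hence for \<open>w\<close> with \<open>(y, w) \<in> R\<^sub>4\<close> the $p^4_{11} = 2$ common \<open>R\<^sub>1\<close>-neighbours of \<open>y\<close>
  and \<open>w\<close> lie both in \<open>N\<close> or both in \<open>M\<close>. The \<open>R\<^sub>3\<close>-triangle \<open>T\<close> of a vertex \<open>R\<^sub>4\<close>-related to \<open>y\<close>
  consists of such vertices \<open>w\<close>, and each element of \<open>N\<close> has exactly one \<open>R\<^sub>1\<close>-neighbour in \<open>T\<close>. So
  counting the \<open>R\<^sub>1\<close>-pairs between \<open>N\<close> and \<open>T\<close> shows that \<open>card N = 3\<close> is even.
\<close>

locale prescribed_scheme =
  fixes X :: "'a set" and R :: "nat \<Rightarrow> 'a rel"
  assumes scheme: "symmetric_association_scheme X {0..5} R"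
    and intersection_number:
      "\<And>h i j. h \<le> 5 \<Longrightarrow> i \<le> 5 \<Longrightarrow> j \<le> 5 \<Longrightarrow>
         is_intersection_number X R h i j (scheme_array ! h ! i ! j)"
begin

lemma finite_X: "finite X"
  using scheme by (simp add: symmetric_association_scheme_def)

lemma R_nonempty: "i \<le> 5 \<Longrightarrow> R i \<noteq> {}"
  using scheme by (simp add: symmetric_association_scheme_def)

lemma R_sym: "(x, y) \<in> R i \<Longrightarrow> i \<le> 5 \<Longrightarrow> (y, x) \<in> R i"
  using scheme by (auto simp: symmetric_association_scheme_def dest: symD)

lemma R_in_X: "(x, y) \<in> R i \<Longrightarrow> i \<le> 5 \<Longrightarrow> x \<in> X \<and> y \<in> X"
proof -
  assume "(x, y) \<in> R i" "i \<le> 5"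
  then have "(x, y) \<in> (\<Union>i\<in>{0..5}. R i)" by auto
  also have "(\<Union>i\<in>{0..5}. R i) = X \<times> X"
    using scheme by (simp add: symmetric_association_scheme_def)
  finally show ?thesis by simp
qed

lemma R_cover:
  assumes "x \<in> X" "y \<in> X"
  obtains i where "i \<le> 5" "(x, y) \<in> R i"
proof -
  have "(x, y) \<in> (\<Union>i\<in>{0..5}. R i)"
    using scheme assms by (simp add: symmetric_association_scheme_def)
  then show ?thesis using that by auto
qed

lemma R_0: "R 0 = Id_on X"
  using scheme by (simp add: symmetric_association_scheme_def)

lemma R_irrefl: "0 < i \<Longrightarrow> i \<le> 5 \<Longrightarrow> (x, x) \<notin> R i"
proof
  assume i: "0 < i" "i \<le> 5" and x: "(x, x) \<in> R i"
  have "R 0 \<inter> R i = {}"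
    using scheme i unfolding symmetric_association_scheme_def
    by (intro disjoint_family_onD[where I = "{0..5}"]) simp_all
  moreover have "(x, x) \<in> R 0" using R_in_X[OF x] i R_0 by auto
  ultimately show False using x by blast
qed

lemma card_common:
  assumes "(x, y) \<in> R h" "h \<le> 5" "i \<le> 5" "j \<le> 5"
  shows "card {z. (x, z) \<in> R i \<and> (z, y) \<in> R j} = scheme_array ! h ! i ! j"
proof -
  have "{z. (x, z) \<in> R i \<and> (z, y) \<in> R j} = {z \<in> X. (x, z) \<in> R i \<and> (z, y) \<in> R j}"
    using R_in_X assms by blast
  then show ?thesis
    using intersection_number[of h i j] assms by (auto simp: is_intersection_number_def)
qed

lemma finite_nbrs: "i \<le> 5 \<Longrightarrow> finite {z. (x, z) \<in> R i}"
  using R_in_X by (auto intro: finite_subset[OF _ finite_X])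

text \<open>This is how zeros of the array are used: once two sides of a triangle are known, the
  nonzero entries limit the third.\<close>

lemma triangle_nonzero:
  assumes "(x, z) \<in> R i" "(z, y) \<in> R j" "(x, y) \<in> R h" "h \<le> 5" "i \<le> 5" "j \<le> 5"
  shows "scheme_array ! h ! i ! j \<noteq> 0"
proof
  assume "scheme_array ! h ! i ! j = 0"
  moreover have "finite {z. (x, z) \<in> R i \<and> (z, y) \<in> R j}"
    using finite_nbrs[of i x] assms by (auto intro: finite_subset)
  ultimately have "{z. (x, z) \<in> R i \<and> (z, y) \<in> R j} = {}"
    using card_common[of x y h i j] assms by simp
  then show False using assms by blast
qed

lemma index_cases: "i \<le> 5 \<Longrightarrow> i \<in> {0, 1, 2, 3, 4, 5 :: nat}"
  by auto

text \<open>In the matrix for \<open>h = 4\<close>, row 2 is nonzero only in column 2.\<close>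

lemma R_comp_4_2:
  assumes "(x, y) \<in> R 4" "(x, z) \<in> R 2"
  shows "(y, z) \<in> R 2"
proof -
  have "y \<in> X" "z \<in> X" using R_in_X[OF assms(1)] R_in_X[OF assms(2)] by auto
  then obtain j where j: "j \<le> 5" "(z, y) \<in> R j" using R_cover by blast
  have "scheme_array ! 4 ! 2 ! j \<noteq> 0"
    using triangle_nonzero[of x z 2 y j 4] assms j by simp
  then have "j = 2" using index_cases[OF j(1)] by (auto simp: scheme_array_def)
  then show ?thesis using j R_sym by blast
qed

text \<open>In the matrix for \<open>h = 4\<close>, column 3 is nonzero only in row 4.\<close>

lemma R_comp_4_3:
  assumes "(y, u) \<in> R 4" "(u, w) \<in> R 3"
  shows "(y, w) \<in> R 4"
proof -
  have "y \<in> X" "w \<in> X" using R_in_X[OF assms(1)] R_in_X[OF assms(2)] by auto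
  then obtain j where j: "j \<le> 5" "(y, w) \<in> R j" using R_cover by blast
  have "scheme_array ! 4 ! j ! 3 \<noteq> 0"
    using triangle_nonzero[of y w j u 3 4] assms j R_sym by simp
  then have "j = 4" using index_cases[OF j(1)] by (auto simp: scheme_array_def)
  then show ?thesis using j by simp
qed

text \<open>Only \<open>h = 1\<close> and \<open>h = 5\<close> have a nonzero entry at (1, 4). For
  \<open>h = 1\<close> the one neighbour is \<open>u\<close> itself, since the entry at (1, 3) is 0;
  for \<open>h = 5\<close> that entry is 1 and \<open>u\<close> is not a neighbour.\<close>

lemma unique_nbr_in_triangle:
  assumes "(z, y) \<in> R 1" "(y, u) \<in> R 4"
  shows "card {w \<in> insert u {w. (u, w) \<in> R 3}. (z, w) \<in> R 1} = 1"
proof -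
  have "z \<in> X" "u \<in> X" using R_in_X[OF assms(1)] R_in_X[OF assms(2)] by auto
  then obtain h where h: "h \<le> 5" "(z, u) \<in> R h" using R_cover by blast
  have "scheme_array ! h ! 1 ! 4 \<noteq> 0"
    using triangle_nonzero[of z y 1 u 4 h] assms h by simp
  then have cases: "h = 1 \<or> h = 5" using index_cases[OF h(1)] by (auto simp: scheme_array_def)
  let ?W = "{w. (z, w) \<in> R 1 \<and> (w, u) \<in> R 3}"
  have "finite ?W" using finite_nbrs[of 1 z] by (auto intro: finite_subset)
  have sym3: "(u, w) \<in> R 3 \<longleftrightarrow> (w, u) \<in> R 3" for w using R_sym by auto
  have card_W: "card ?W = scheme_array ! h ! 1 ! 3" using card_common[OF h(2,1)] by simp
  show ?thesis
  proof (cases "(z, u) \<in> R 1")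
    case True
    have "card ?W = 0" using card_common[OF True, of 1 3] by (simp add: scheme_array_def)
    then have "?W = {}" using \<open>finite ?W\<close> by simp
    then have "{w \<in> insert u {w. (u, w) \<in> R 3}. (z, w) \<in> R 1} = {u}"
      using True sym3 by blast
    then show ?thesis by simp
  next
    case False
    then have "{w \<in> insert u {w. (u, w) \<in> R 3}. (z, w) \<in> R 1} = ?W"
      using sym3 by blast
    moreover have "h = 5" using False h cases by auto
    ultimately show ?thesis using card_W by (simp add: scheme_array_def)
  qed
qed

lemma contradiction: False
proof -
  obtain y x where yx: "(y, x) \<in> R 1" using R_nonempty[of 1] by fastforce
  \<comment> \<open>\<open>u\<close> has to be related to this very \<open>y\<close>, so it comes
    from the valency 6 of \<open>R 4\<close>, the entry (4, 4) for \<open>h = 0\<close>.\<close>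
  have "(y, y) \<in> R 0" using R_in_X[OF yx] R_0 by auto
  from card_common[OF this, of 4 4]
  have "{u. (y, u) \<in> R 4 \<and> (u, y) \<in> R 4} \<noteq> {}" by (force simp: scheme_array_def)
  then obtain u where u: "(y, u) \<in> R 4" by auto
  let ?P = "{z. (y, z) \<in> R 1 \<and> (z, x) \<in> R 4}"
  define N where "N = insert x ?P"
  define T where "T = insert u {w. (u, w) \<in> R 3}"
  have "finite ?P" using finite_nbrs[of 1 y] by (auto intro: finite_subset)
  moreover have "x \<notin> ?P" using R_irrefl[of 4 x] by simp
  moreover have "card ?P = 2" using card_common[OF yx, of 1 4] by (simp add: scheme_array_def)
  ultimately have N: "finite N" "card N = 3" by (simp_all add: N_def)
  have "finite T" using finite_nbrs[of 3 u] by (simp add: T_def)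
  have N_nbr: "(y, z) \<in> R 1" if "z \<in> N" for z using that yx by (auto simp: N_def)
  have T_R4: "(y, w) \<in> R 4" if "w \<in> T" for w
    using that u R_comp_4_3 by (auto simp: T_def)
  have not_N: "(x, m) \<in> R 2" if m: "(y, m) \<in> R 1" "m \<notin> N" for m
  proof -
    have "m \<in> X" "x \<in> X" using R_in_X[OF m(1)] R_in_X[OF yx] by auto
    then obtain j where j: "j \<le> 5" "(m, x) \<in> R j" using R_cover by blast
    \<comment> \<open>Of the three possible indices, 0 and 4 would put \<open>m\<close> into
      \<open>N\<close>.\<close>
    have "scheme_array ! 1 ! 1 ! j \<noteq> 0"
      using triangle_nonzero[of y m 1 x j 1] yx m j by simp
    then have "j = 0 \<or> j = 2 \<or> j = 4"
      using index_cases[OF j(1)] by (auto simp: scheme_array_def)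
    moreover have "j \<noteq> 0"
    proof
      assume "j = 0"
      then have "(m, x) \<in> Id_on X" using j R_0 by simp
      then show False using m by (auto simp: N_def)
    qed
    moreover have "j \<noteq> 4" using j m by (auto simp: N_def)
    ultimately show ?thesis using j R_sym by blast
  qed
  have N_M: "(z, m) \<in> R 2" if "z \<in> N" "(y, m) \<in> R 1" "m \<notin> N" for z m
    using that not_N[of m] R_comp_4_2[of x z m] R_sym[of z x 4] by (auto simp: N_def)
  have even_N: "even (card {z \<in> N. (z, w) \<in> R 1})" if w: "w \<in> T" for w
  proof -
    let ?C = "{z. (y, z) \<in> R 1 \<and> (z, w) \<in> R 1}"
    have "w \<noteq> y" using T_R4[OF w] R_irrefl[of 4 y] by auto
    have card_C: "card ?C = 2"
      using card_common[OF T_R4[OF w], of 1 1] by (simp add: scheme_array_def)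
    have mixed: False if z: "z \<in> N" "z \<in> ?C" and m: "m \<notin> N" "m \<in> ?C" for z m
    proof -
      have "(z, m) \<in> R 2" using N_M z m by auto
      from card_common[OF this, of 1 1]
      have "card {v. (z, v) \<in> R 1 \<and> (v, m) \<in> R 1} = 1" by (simp add: scheme_array_def)
      moreover have "{y, w} \<subseteq> {v. (z, v) \<in> R 1 \<and> (v, m) \<in> R 1}"
        using z m R_sym by auto
      ultimately show False using \<open>w \<noteq> y\<close>
        by (metis (no_types, lifting) card_1_singletonE insert_subset singletonD)
    qed
    have "{z \<in> N. (z, w) \<in> R 1} = {z \<in> ?C. z \<in> N}" using N_nbr by auto
    \<comment> \<open>Without mixed pairs \<open>?C\<close> lies wholly inside or wholly outside
      \<open>N\<close>.\<close>
    also have "\<dots> = {} \<or> \<dots> = ?C" using mixed by blast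
    finally have "card {z \<in> N. (z, w) \<in> R 1} = 0 \<or> card {z \<in> N. (z, w) \<in> R 1} = 2"
      using card_C by (elim disjE) (simp_all only: card.empty simp_thms)
    then show ?thesis by (elim disjE) (simp_all only: even_zero even_numeral)
  qed
  \<comment> \<open>Each summand is 1; after swapping the order of counting, each summand is
    even.\<close>
  have "card N = (\<Sum>z\<in>N. card {w \<in> T. (z, w) \<in> R 1})"
    using unique_nbr_in_triangle[OF _ u] N_nbr R_sym by (simp add: T_def)
  also have "\<dots> = (\<Sum>w\<in>T. card {z \<in> N. (z, w) \<in> R 1})"
    using sum.swap_restrict[OF N(1) \<open>finite T\<close>, of "\<lambda>_ _. 1::nat" "\<lambda>z w. (z, w) \<in> R 1"]
    by simp
  also have "even \<dots>" using even_N by (simp add: dvd_sum)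
  finally show False using N(2) by simp
qed

end

theorem theorem5p4:
  shows "\<not> (\<exists>(X :: 'a set) (R :: nat \<Rightarrow> 'a rel).
    symmetric_association_scheme X {0..5} R \<and>
    (\<forall>h\<in>{0..5}. \<forall>i\<in>{0..5}. \<forall>j\<in>{0..5}.
       is_intersection_number X R h i j (scheme_array ! h ! i ! j)))"
proof
  assume "\<exists>(X :: 'a set) (R :: nat \<Rightarrow> 'a rel).
    symmetric_association_scheme X {0..5} R \<and>
    (\<forall>h\<in>{0..5}. \<forall>i\<in>{0..5}. \<forall>j\<in>{0..5}.
       is_intersection_number X R h i j (scheme_array ! h ! i ! j))"
  then obtain X :: "'a set" and R where "prescribed_scheme X R"
    unfolding prescribed_scheme_def by (metis atLeastAtMost_iff zero_le)
  then show False by (rule prescribed_scheme.contradiction)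
qed

end
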